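(* Let $m<n$ be positive integers. Let $\mathcal{A}=(A_1,\dots,A_{n+m-1})$ be a family of $n+m-1$ (not necessarily distinct) sets, each consisting of $m$ mutually disjoint horizontal line segments in the plane. Let $L$ be the set of all horizontal lines that meet $\bigcup_{A\in\mathcal{A}}A$ (the union of all segments in all the $A_i$). If $|L|\ge m(n-m)+1$, then $\mathcal{A}$ has an SDR of size $n$.
   Context: A horizontal line segment is a line segment contained in a line of the form $\mathbb{R}\times\{y\}$. Given families $A_1,\dots,A_N$ of nonempty sets, a system of disjoint representatives (SDR) of size $n$ is a set $\{S_1,\dots,S_n\}$ of mutually disjoint sets in $\bigcup_i A_i$ such that there are distinct indices $p_1,\dots,p_n\in[N]$ with $S_j\in A_{p_j}$ for all $j\in[n]$. *)

theory Defs
  imports "HOL-Analysis.Analysis"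
begin

text \<open>
  The plane is \<^typ>\<open>real \<times> real\<close>. A segment is closed, and its two endpoints may coincide.
\<close>

definition horizontal_line :: "(real \<times> real) set \<Rightarrow> bool" where
  "horizontal_line l \<longleftrightarrow> (\<exists>y. l = UNIV \<times> {y})"

definition horizontal_segment :: "(real \<times> real) set \<Rightarrow> bool" where
  "horizontal_segment S \<longleftrightarrow>
     (\<exists>a b. S = closed_segment a b) \<and> (\<exists>l. horizontal_line l \<and> S \<subseteq> l)"

text \<open>
  \<open>T\<close> is the set of representatives; an injective \<open>p\<close> gives the distinct indices of the families
  from which they are taken.
\<close>

definition is_SDR :: "'i set \<Rightarrow> ('i \<Rightarrow> 'a set set) \<Rightarrow> nat \<Rightarrow> 'a set set \<Rightarrow> bool" where
  "is_SDR I A n T \<longleftrightarrow>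
     finite T \<and> card T = n \<and> disjoint T \<and>
     (\<exists>p. inj_on p T \<and> (\<forall>S\<in>T. p S \<in> I \<and> S \<in> A (p S)))"

end

theory Submission
  imports Defs
begin

text \<open>
  Only two features of horizontal segments matter: intersecting segments lie on the same line, and
  among finitely many segments on a line the one whose right endpoint is leftmost is met only by
  segments containing that endpoint, hence by at most one member of each family.
  Allow family sizes between \<open>m\<close> and \<open>M\<close>, and ask for \<open>m + k\<close> representatives from \<open>m + k\<close>
  families that meet more than \<open>M (k - 1) + m\<close> lines (no condition on lines if \<open>k = 0\<close>); induct on \<open>m + k\<close>.
  If some line is met by a single family, take a representative there and drop that family: \<open>k\<close>
  decreases and at most \<open>M\<close> lines are lost. Otherwise take an extreme segment and drop its family
  together with all segments meeting it: \<open>m\<close> decreases and at most one line is lost. If \<open>m = 0\<close>, one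
  can afford to drop all lines met by the chosen family.
\<close>

section \<open>Representatives in abstract set families\<close>

text \<open>\<open>B\<close> is \<open>A\<close> with the members meeting \<open>S\<close>
  discarded, so \<open>S\<close> can be added to any system for \<open>B\<close>;
  \<open>S \<noteq> {}\<close> ensures that \<open>S\<close> is not already in
  \<open>T\<close>.\<close>

lemma is_SDR_insert:
  assumes "is_SDR (I - {i}) B n T" "i \<in> I" "S \<in> A i" "S \<noteq> {}"
    and "\<And>j. j \<in> I - {i} \<Longrightarrow> B j \<subseteq> A j"
    and "\<And>j R. j \<in> I - {i} \<Longrightarrow> R \<in> B j \<Longrightarrow> R \<inter> S = {}"
  shows "is_SDR I A (Suc n) (insert S T)"
proof -
  from assms(1) obtain p where T: "finite T" "card T = n" "disjoint T"
    and p: "inj_on p T" "\<And>R. R \<in> T \<Longrightarrow> p R \<in> I - {i} \<and> R \<in> B (p R)"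
    unfolding is_SDR_def by blast
  have disj: "R \<inter> S = {}" if "R \<in> T" for R
    using p(2)[OF that] assms(6) by blast
  have S: "S \<notin> T"
    using disj assms(4) by blast
  have "inj_on (p(S := i)) (insert S T)"
    using p S by (auto simp: inj_on_def)
  moreover have "\<forall>R\<in>insert S T. (p(S := i)) R \<in> I \<and> R \<in> A ((p(S := i)) R)"
    using p(2) S assms(2,3,5) by fastforce
  moreover have "disjoint (insert S T)"
    using T(3) disj by (auto simp: pairwise_insert disjnt_def)
  ultimately show ?thesis
    using T(1,2) S unfolding is_SDR_def by (intro conjI exI[of _ "p(S := i)"]) auto
qed

text \<open>\<open>h\<close> stands for the line carrying a segment. Separate bounds
  \<open>m\<close> and \<open>M\<close> are needed because discarding the sets that meet an extreme
  one shrinks some families but not others.\<close>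

lemma SDR_of_extreme_sets:
  fixes A :: "'i \<Rightarrow> 'a set set" and h :: "'a set \<Rightarrow> 'l"
  assumes same_line: "\<And>S T. S \<in> U \<Longrightarrow> T \<in> U \<Longrightarrow> S \<inter> T \<noteq> {} \<Longrightarrow> h S = h T"
    and extreme: "\<And>F. finite F \<Longrightarrow> F \<subseteq> U \<Longrightarrow> F \<noteq> {} \<Longrightarrow>
      \<exists>S\<in>F. \<exists>p\<in>S. \<forall>T\<in>F. T \<inter> S \<noteq> {} \<longrightarrow> p \<in> T"
    and "finite I"
    and "\<And>i. i \<in> I \<Longrightarrow> finite (A i) \<and> disjoint (A i) \<and> A i \<subseteq> U \<and> m \<le> card (A i) \<and> card (A i) \<le> M"
    and "m + k \<le> card I"
    and "0 < k \<Longrightarrow> M * (k - 1) + m < card (h ` \<Union>(A ` I))"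
  shows "\<exists>T. is_SDR I A (m + k) T"
  using assms(3-6)
proof (induction "m + k" arbitrary: m k I A)
  case 0
  have "is_SDR I A 0 {}"
    by (simp add: is_SDR_def)
  with 0 show ?case by metis
next
  case (Suc n)
  note IH = Suc.hyps(1) and n = Suc.hyps(2)
  note fin = Suc.prems(1) and A = Suc.prems(2) and I = Suc.prems(3) and lines = Suc.prems(4)
  define L where "L = (\<lambda>J. h ` \<Union>(A ` J))"
  have nonempty: "S \<noteq> {}" if "S \<in> U" for S
    using extreme[of "{S}"] that by auto
  have card_hA: "card (h ` A i) \<le> M" if "i \<in> I" for i
    using A[OF that] card_image_le le_trans by blast
  have card_I: "m + k - 1 \<le> card (I - {i})" for i
    using I fin by (cases "i \<in> I") auto
  \<comment> \<open>In the first case only family \<open>i\<close> meets the line of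
    \<open>S\<close>. If \<open>k = 0\<close>, then \<open>m + k = Suc n\<close> forces
    \<open>0 < m\<close>, and the third case applies with no condition on lines.\<close>
  consider (drop_family) i S where "0 < k" "i \<in> I" "S \<in> A i" "h S \<notin> L (I - {i})"
    | (no_size) "0 < k" "m = 0"
    | (drop_extreme) "0 < m" "0 < k \<Longrightarrow> \<forall>i\<in>I. h ` A i \<subseteq> L (I - {i})"
    using n by fastforce
  then show ?case
  proof cases
    case drop_family
    \<comment> \<open>For \<open>k = 1\<close> the induction hypothesis asks nothing about lines, so
      the truncated \<open>k - 1 - 1\<close> does no harm.\<close>
    have "M * (k - 1 - 1) + m < card (h ` \<Union>(A ` (I - {i})))" if "0 < k - 1"
    proof -
      have "L I = L (I - {i}) \<union> h ` A i"
        using drop_family(2) by (auto simp: L_def)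
      then have "card (L I) \<le> card (L (I - {i})) + M"
        using card_Un_le[of "L (I - {i})" "h ` A i"] card_hA[OF drop_family(2)] by simp
      moreover have "M * (k - 1) = M * (k - 1 - 1) + M"
        using that by (cases "k - 1") auto
      ultimately show ?thesis
        using lines[OF drop_family(1)] by (simp add: L_def)
    qed
    then have "\<exists>T. is_SDR (I - {i}) A (m + (k - 1)) T"
      using n fin A card_I[of i] drop_family(1) by (intro IH) simp_all
    then obtain T where T: "is_SDR (I - {i}) A (m + (k - 1)) T" ..
    have "R \<inter> S = {}" if "j \<in> I - {i}" "R \<in> A j" for j R
    proof (rule ccontr)
      assume "R \<inter> S \<noteq> {}"
      then have "h S = h R"
        using same_line A that drop_family(2,3) by blast
      then show False
        using that drop_family(4) unfolding L_def by blast
    qed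
    moreover have "S \<noteq> {}"
      using nonempty A drop_family by blast
    ultimately have "is_SDR I A (Suc (m + (k - 1))) (insert S T)"
      using is_SDR_insert[where A = A, OF T drop_family(2,3)] by blast
    then show ?thesis
      using drop_family(1) by auto
  next
    case no_size
    \<comment> \<open>With \<open>m = 0\<close> families may be empty; the bound on lines still
      provides some set to choose.\<close>
    have "card (L I) \<noteq> 0"
      using lines no_size unfolding L_def by linarith
    then have "L I \<noteq> {}"
      by auto
    then obtain i S where S: "i \<in> I" "S \<in> A i"
      by (auto simp: L_def)
    \<comment> \<open>The lower size bound is now 0, so arbitrarily many sets may be discarded; the
      at most \<open>M\<close> lost lines are paid for by lowering \<open>k\<close>.\<close>
    define B where "B = (\<lambda>j. {R \<in> A j. h R \<notin> h ` A i})"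
    have B: "finite (B j) \<and> disjoint (B j) \<and> B j \<subseteq> U \<and> 0 \<le> card (B j) \<and> card (B j) \<le> M"
      if "j \<in> I - {i}" for j
    proof -
      have "B j \<subseteq> A j" by (auto simp: B_def)
      moreover from this have "card (B j) \<le> card (A j)"
        using A that by (intro card_mono) auto
      ultimately show ?thesis
        using A[of j] that by (auto intro: finite_subset pairwise_subset)
    qed
    have "M * (k - 1 - 1) + 0 < card (h ` \<Union>(B ` (I - {i})))" if "0 < k - 1"
    proof -
      have "L I \<subseteq> h ` \<Union>(B ` (I - {i})) \<union> h ` A i"
      proof
        fix y assume "y \<in> L I"
        then obtain j R where R: "j \<in> I" "R \<in> A j" "y = h R"
          by (auto simp: L_def)
        show "y \<in> h ` \<Union>(B ` (I - {i})) \<union> h ` A i"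
        proof (cases "h R \<in> h ` A i")
          case False
          then have "R \<in> B j" "j \<noteq> i"
            using R by (auto simp: B_def)
          then show ?thesis
            using R by blast
        qed (use R in simp)
      qed
      then have "card (L I) \<le> card (h ` \<Union>(B ` (I - {i})) \<union> h ` A i)"
        using fin A B S(1) by (intro card_mono) auto
      also have "\<dots> \<le> card (h ` \<Union>(B ` (I - {i}))) + M"
        using card_Un_le[of "h ` \<Union>(B ` (I - {i}))" "h ` A i"] card_hA[OF S(1)] by linarith
      finally have "card (L I) \<le> card (h ` \<Union>(B ` (I - {i}))) + M" .
      moreover have "M * (k - 1) = M * (k - 1 - 1) + M"
        using that by (cases "k - 1") auto
      ultimately show ?thesis
        using lines[OF no_size(1)] no_size by (simp add: L_def)
    qed
    then have "\<exists>T. is_SDR (I - {i}) B (0 + (k - 1)) T"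
      using n fin B card_I[of i] no_size by (intro IH) simp_all
    then obtain T where T: "is_SDR (I - {i}) B (0 + (k - 1)) T" ..
    have "R \<inter> S = {}" if "j \<in> I - {i}" "R \<in> B j" for j R
      using same_line[of R S] A that S unfolding B_def by blast
    moreover have "S \<noteq> {}"
      using nonempty A S by blast
    moreover have "B j \<subseteq> A j" for j
      by (auto simp: B_def)
    ultimately have "is_SDR I A (Suc (0 + (k - 1))) (insert S T)"
      using is_SDR_insert[where A = A, OF T S] by blast
    then show ?thesis
      using no_size by auto
  next
    case drop_extreme
    have "I \<noteq> {}"
      using I drop_extreme(1) by auto
    then obtain i0 where "i0 \<in> I" by blast
    moreover from this have "A i0 \<noteq> {}"
      using A[of i0] drop_extreme(1) by auto
    ultimately have "\<Union>(A ` I) \<noteq> {}" by blast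
    moreover have "finite (\<Union>(A ` I))" "\<Union>(A ` I) \<subseteq> U"
      using fin A by auto
    ultimately obtain S p where S: "S \<in> \<Union>(A ` I)" "p \<in> S"
      and p: "\<And>T. T \<in> \<Union>(A ` I) \<Longrightarrow> T \<inter> S \<noteq> {} \<Longrightarrow> p \<in> T"
      using extreme[of "\<Union>(A ` I)"] by metis
    from S obtain i where i: "i \<in> I" "S \<in> A i" by blast
    define B where "B = (\<lambda>j. {R \<in> A j. R \<inter> S = {}})"
    have B: "finite (B j) \<and> disjoint (B j) \<and> B j \<subseteq> U \<and> m - 1 \<le> card (B j) \<and> card (B j) \<le> M"
      if j: "j \<in> I - {i}" for j
    proof -
      have Aj: "finite (A j)" "disjoint (A j)" "A j \<subseteq> U" "m \<le> card (A j)" "card (A j) \<le> M"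
        using A[of j] j by auto
      have BA: "B j \<subseteq> A j" by (auto simp: B_def)
      then have "card (B j) \<le> card (A j)"
        using Aj by (intro card_mono) auto
      \<comment> \<open>All discarded members contain \<open>p\<close>, and members of
        \<open>A j\<close> are disjoint.\<close>
      moreover have "card (A j - B j) \<le> 1"
      proof (rule card_le_Suc0_iff_eq[THEN iffD2, unfolded One_nat_def[symmetric]])
        show "finite (A j - B j)" using Aj by auto
        show "\<forall>R\<in>A j - B j. \<forall>R'\<in>A j - B j. R = R'"
        proof (intro ballI)
          fix R R' assume "R \<in> A j - B j" "R' \<in> A j - B j"
          then have "R \<in> A j" "R' \<in> A j" "p \<in> R" "p \<in> R'"
            using p j by (auto simp: B_def)
          then show "R = R'"
            using Aj(2) by (metis disjnt_iff pairwiseD)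
        qed
      qed
      moreover have "card (A j - B j) = card (A j) - card (B j)"
        using BA Aj(1) finite_subset by (intro card_Diff_subset) auto
      ultimately show ?thesis
        using Aj BA by (auto intro: finite_subset pairwise_subset)
    qed
    have "M * (k - 1) + (m - 1) < card (h ` \<Union>(B ` (I - {i})))" if k: "0 < k"
    proof -
      \<comment> \<open>Dropping family \<open>i\<close> loses no line, since other families meet
        each of its lines; discarding the sets that meet \<open>S\<close> can lose only the line of
        \<open>S\<close>.\<close>
      have "L I \<subseteq> insert (h S) (h ` \<Union>(B ` (I - {i})))"
      proof
        fix y assume "y \<in> L I"
        then have "y \<in> L (I - {i})"
          using drop_extreme(2)[OF k] i(1) unfolding L_def by blast
        then obtain j R where R: "j \<in> I - {i}" "R \<in> A j" "y = h R"
          by (auto simp: L_def)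
        show "y \<in> insert (h S) (h ` \<Union>(B ` (I - {i})))"
        proof (cases "R \<inter> S = {}")
          case True
          then show ?thesis using R by (auto simp: B_def)
        next
          case False
          then have "h R = h S"
            using same_line A R i by blast
          then show ?thesis using R by simp
        qed
      qed
      then have "card (L I) \<le> card (insert (h S) (h ` \<Union>(B ` (I - {i}))))"
        using fin B by (intro card_mono) auto
      also have "\<dots> \<le> Suc (card (h ` \<Union>(B ` (I - {i}))))"
        by (rule card_insert_le_m1) auto
      finally show ?thesis
        using lines[OF k] drop_extreme(1) by (simp add: L_def)
    qed
    then have "\<exists>T. is_SDR (I - {i}) B (m - 1 + k) T"
      using n fin B card_I[of i] drop_extreme(1) by (intro IH) simp_all
    then obtain T where T: "is_SDR (I - {i}) B (m - 1 + k) T" ..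
    have "is_SDR I A (Suc (m - 1 + k)) (insert S T)"
      using S(2) by (intro is_SDR_insert[where A = A, OF T i]) (auto simp: B_def)
    then show ?thesis
      using drop_extreme(1) by auto
  qed
qed

section \<open>Horizontal segments and their lines\<close>

lemma horizontal_segmentE:
  assumes "horizontal_segment S"
  obtains a b y where "a \<le> b" "S = {a..b} \<times> {y}"
proof -
  obtain P Q y where S: "S = closed_segment P Q" "S \<subseteq> UNIV \<times> {y}"
    using assms unfolding horizontal_segment_def horizontal_line_def by blast
  obtain a b where P: "P = (a, y)" and Q: "Q = (b, y)"
    using S by (cases P; cases Q) auto
  have "S = closed_segment a b \<times> {y}"
  proof -
    have "(1 - u) * y + u * y = y" for u by (simp add: algebra_simps)
    then show ?thesis
      unfolding S(1) P Q by (fastforce simp: closed_segment_def)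
  qed
  then show ?thesis
    using that[of "min a b" "max a b" y] by (auto simp: closed_segment_eq_real_ivl)
qed

text \<open>Take \<open>S\<close> with the leftmost right endpoint in all of \<open>F\<close>,
  whatever its line. A segment meeting \<open>S\<close> lies on the same line, starts no later than
  that endpoint and ends no earlier, so it contains it.\<close>

lemma extreme_segment:
  assumes "finite F" "\<And>S. S \<in> F \<Longrightarrow> horizontal_segment S" "F \<noteq> {}"
  shows "\<exists>S\<in>F. \<exists>p\<in>S. \<forall>T\<in>F. T \<inter> S \<noteq> {} \<longrightarrow> p \<in> T"
proof -
  obtain S where S: "S \<in> F" "\<And>T. T \<in> F \<Longrightarrow> Sup (fst ` S) \<le> Sup (fst ` T)"
    using arg_min_if_finite[OF assms(1,3), of "\<lambda>S. Sup (fst ` S)"] not_le by blast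
  obtain a b y where ab: "a \<le> b" "S = {a..b} \<times> {y}"
    using assms(2)[OF S(1)] by (rule horizontal_segmentE)
  have "(b, y) \<in> T" if T: "T \<in> F" "T \<inter> S \<noteq> {}" for T
  proof -
    obtain c d z where cd: "c \<le> d" "T = {c..d} \<times> {z}"
      using assms(2)[OF T(1)] by (rule horizontal_segmentE)
    have "b \<le> d"
      using S(2)[OF T(1)] ab cd by simp
    then show ?thesis
      using T(2) ab cd by auto
  qed
  moreover have "(b, y) \<in> S"
    using ab by auto
  ultimately show ?thesis
    using S(1) by blast
qed

theorem theorem2p3:
  fixes m n :: nat
    and A :: "nat \<Rightarrow> (real \<times> real) set set"
    and L :: "(real \<times> real) set set"
  assumes "0 < m" and "m < n"
    and "\<And>i. i \<in> {1..n + m - 1} \<Longrightarrow>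
           card (A i) = m \<and> disjoint (A i) \<and> (\<forall>S\<in>A i. horizontal_segment S)"
    and "L = {l. horizontal_line l \<and> l \<inter> \<Union>(\<Union>i\<in>{1..n + m - 1}. A i) \<noteq> {}}"
    and "card L \<ge> m * (n - m) + 1"
  shows "\<exists>T. is_SDR {1..n + m - 1} A n T"
proof -
  let ?I = "{1..n + m - 1}"
  \<comment> \<open>\<open>snd\<close> is constant on a horizontal segment, so this is the line
    carrying it.\<close>
  define line :: "(real \<times> real) set \<Rightarrow> (real \<times> real) set" where "line S = UNIV \<times> snd ` S" for S
  have line: "line S = UNIV \<times> {y}" if "horizontal_segment S" "(x, y) \<in> S" for S x y
    using that by (elim horizontal_segmentE) (force simp: line_def)
  have fin: "finite (A i)" if "i \<in> ?I" for i
    \<comment> \<open>An infinite set has \<open>card\<close> 0, which \<open>0 < m\<close>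
      excludes.\<close>
    using assms(3)[OF that] assms(1) card.infinite by fastforce
  have "L \<subseteq> line ` \<Union>(A ` ?I)"
  proof
    fix l assume "l \<in> L"
    then obtain x y i S where l: "l = UNIV \<times> {y}" "i \<in> ?I" "S \<in> A i" "(x, y) \<in> S"
      unfolding assms(4) horizontal_line_def by fastforce
    then have "l = line S"
      using line assms(3) by metis
    then show "l \<in> line ` \<Union>(A ` ?I)"
      using l by blast
  qed
  then have "card L \<le> card (line ` \<Union>(A ` ?I))"
    using fin by (intro card_mono) auto
  moreover have "m * (n - m) = m * (n - m - 1) + m"
    using assms(2) by (cases "n - m") auto
  ultimately have lines: "m * (n - m - 1) + m < card (line ` \<Union>(A ` ?I))"
    using assms(5) by linarith
  have "\<exists>T. is_SDR ?I A (m + (n - m)) T"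
  \<comment> \<open>Here \<open>k = n - m\<close>, and \<open>0 < m\<close> makes the
    \<open>n + m - 1\<close> families at least \<open>m + k = n\<close> in number.\<close>
  proof (rule SDR_of_extreme_sets[where U = "Collect horizontal_segment" and h = line and M = m])
    show "line S = line T"
      if "S \<in> Collect horizontal_segment" "T \<in> Collect horizontal_segment" "S \<inter> T \<noteq> {}" for S T
      using that line by fastforce
    show "\<exists>S\<in>F. \<exists>p\<in>S. \<forall>T\<in>F. T \<inter> S \<noteq> {} \<longrightarrow> p \<in> T"
      if "finite F" "F \<subseteq> Collect horizontal_segment" "F \<noteq> {}" for F
      using that by (intro extreme_segment) auto
    show "finite (A i) \<and> disjoint (A i) \<and> A i \<subseteq> Collect horizontal_segment \<and> m \<le> card (A i) \<and> card (A i) \<le> m"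
      if "i \<in> ?I" for i
      using assms(3)[OF that] fin[OF that] by auto
  qed (use assms(1,2) lines in auto)
  then show ?thesis
    using assms(2) by simp
qed

end
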